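(* Let $k$ be a positive integer. If $E$ is a subset of $\mathbb{F}_q$ with size $|E|>\dfrac{qk}{\sqrt{q-1}}$, then it contains at least two distinct elements whose difference is a $k$-th power. Thus, in particular, if $k$ is fixed and $|E|=\Omega\left(\sqrt{q}\right)$ as $q\to\infty$, then $E$ contains at least two distinct elements whose difference is a $k$-th power.
   Context: Here $\mathbb{F}_q$ denotes the finite field with $q$ elements, and a $k$-th power means an element of the form $\alpha^k$ with $\alpha\in\mathbb{F}_q$.
   Formalization: With an arbitrary constant in Ω(√q) the second claim is false (k=2, q=p², E=g·F_p, g a nonsquare); it is proved for |E| ≥ C√q with any constant C > k and q large, for fields whose elements are natural numbers, which covers every finite field up to isomorphism. *)

theory Defs
  imports Complex_Main "HOL-Algebra.Ring"
begin

(* Zero counts as a k-th power for k > 0, since alpha ranges over all of the carrier. *)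
definition is_kth_power :: "('a, 'b) ring_scheme \<Rightarrow> nat \<Rightarrow> 'a \<Rightarrow> bool"
  where "is_kth_power F k x \<longleftrightarrow> (\<exists>\<alpha>\<in>carrier F. x = \<alpha> [^]\<^bsub>F\<^esub> k)"

definition has_kth_power_difference :: "('a, 'b) ring_scheme \<Rightarrow> nat \<Rightarrow> 'a set \<Rightarrow> bool"
  where "has_kth_power_difference F k E \<longleftrightarrow>
    (\<exists>x\<in>E. \<exists>y\<in>E. x \<noteq> y \<and> is_kth_power F k (x \<ominus>\<^bsub>F\<^esub> y))"

(* "If |E| = Omega(sqrt q) as q \<rightarrow> \<infinity>, then E has distinct elements differing by a k-th power",
   with implied constant C.  The threshold on q may depend on k and C, but not on the field or
   on E.  As every finite field is isomorphic to one whose carrier is a set of naturals, it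
   suffices to let F range over such fields; this allows the field to be quantified inside. *)
definition eventually_kth_power_difference :: "nat \<Rightarrow> real \<Rightarrow> bool"
  where "eventually_kth_power_difference k C \<longleftrightarrow>
    (\<forall>\<^sub>F q in sequentially. \<forall>(F :: nat ring) E.
        field F \<longrightarrow> finite (carrier F) \<longrightarrow> card (carrier F) = q \<longrightarrow> E \<subseteq> carrier F \<longrightarrow>
        real (card E) \<ge> C * sqrt (real q) \<longrightarrow> has_kth_power_difference F k E)"

end

theory Submission
  imports Defs "HOL-Algebra.Multiplicative_Group" "HOL-Real_Asymp.Real_Asymp"
begin

text \<open>
  Let \<open>P\<close> be the group of nonzero \<open>k\<close>-th powers and suppose that no two distinct elements of \<open>E\<close>
  differ by a \<open>k\<close>-th power. For \<open>t \<in> P\<close> and \<open>y \<in> E\<close> the line \<open>s = t x - t y\<close> then misses the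
  point set \<open>E \<times> P\<close>, since \<open>x - y = s / t\<close> would be a power. This gives \<open>|E| |P|\<close> lines without
  incidences. Over all \<open>q\<^sup>2\<close> nonvertical lines the number of incidences with \<open>E \<times> P\<close> has mean
  \<open>|E| |P| / q\<close> and total squared deviation exactly \<open>|E| |P| (q - |P|)\<close>, because two points with
  distinct abscissae lie on exactly one such line. Hence \<open>(|E| |P|)\<^sup>2 \<le> q\<^sup>2 (q - |P|)\<close>, and
  \<open>|P| \<ge> (q - 1) / k\<close> finishes the proof.
\<close>

section \<open>Incidences of points with nonvertical lines\<close>

lemma (in field) bij_betw_line_coordinates:
  assumes fin: "finite (carrier R)" and x: "x \<in> carrier R" and y: "y \<in> carrier R" and "x \<noteq> y"
  shows "bij_betw (\<lambda>(t, b). (t \<otimes> x \<ominus> b, t \<otimes> y \<ominus> b))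
           (carrier R \<times> carrier R) (carrier R \<times> carrier R)"
proof -
  let ?f = "\<lambda>(t, b). (t \<otimes> x \<ominus> b, t \<otimes> y \<ominus> b)"
  have "inj_on ?f (carrier R \<times> carrier R)"
  proof (rule inj_onI, clarify)
    fix t b u c
    assume [simp]: "t \<in> carrier R" "b \<in> carrier R" "u \<in> carrier R" "c \<in> carrier R"
      and 1: "t \<otimes> x \<ominus> b = u \<otimes> x \<ominus> c" and 2: "t \<otimes> y \<ominus> b = u \<otimes> y \<ominus> c"
    note carrier [simp] = x y \<open>t \<in> _\<close> \<open>b \<in> _\<close> \<open>u \<in> _\<close> \<open>c \<in> _\<close>
    \<comment> \<open>The intercepts cancel in the difference of the heights over \<open>x\<close>
      and \<open>y\<close>, so equal heights force equal slopes because \<open>x \<noteq> y\<close>;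
      the height over \<open>x\<close> then recovers the intercept.\<close>
    have "(t \<ominus> u) \<otimes> (x \<ominus> y)
        = ((t \<otimes> x \<ominus> b) \<ominus> (u \<otimes> x \<ominus> c)) \<ominus> ((t \<otimes> y \<ominus> b) \<ominus> (u \<otimes> y \<ominus> c))"
      using carrier by algebra
    also have "\<dots> = \<zero>"
      unfolding 1 2 using carrier by algebra
    finally have "t \<ominus> u = \<zero>"
      using integral_iff[of "t \<ominus> u" "x \<ominus> y"] r_right_minus_eq[OF x y] \<open>x \<noteq> y\<close> by simp
    then have "t = u" by simp
    moreover have "b = t \<otimes> x \<ominus> (t \<otimes> x \<ominus> b)" "c = u \<otimes> x \<ominus> (u \<otimes> x \<ominus> c)"
      using carrier by algebra+
    ultimately show "t = u \<and> b = c" using 1 by metis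
  qed
  moreover have "?f ` (carrier R \<times> carrier R) \<subseteq> carrier R \<times> carrier R"
    using x y by auto
  ultimately show ?thesis
    using endo_inj_surj[of "carrier R \<times> carrier R" ?f] fin by (simp add: bij_betw_def)
qed

lemma (in ring) bij_betw_minus_left:
  assumes "a \<in> carrier R"
  shows "bij_betw (\<lambda>b. a \<ominus> b) (carrier R) (carrier R)"
proof (rule bij_betwI[where g = "\<lambda>b. a \<ominus> b"])
  fix b assume "b \<in> carrier R"
  with assms show "a \<ominus> (a \<ominus> b) = b" "a \<ominus> (a \<ominus> b) = b" by algebra+
qed (use assms in auto)

text \<open>For a fixed slope the height over \<open>x\<close> runs once through the field as the
  intercept does. So every point with abscissa \<open>x\<close> lies on exactly one line of each
  slope.\<close>

lemma (in field) sum_line_incidences: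
  assumes fin: "finite (carrier R)" and x: "x \<in> carrier R" and B: "B \<subseteq> carrier R"
  shows "(\<Sum>(t, b)\<in>carrier R \<times> carrier R. of_bool (t \<otimes> x \<ominus> b \<in> B))
           = real (card (carrier R)) * real (card B)"
proof -
  have "(\<Sum>b\<in>carrier R. of_bool (t \<otimes> x \<ominus> b \<in> B)) = real (card B)" if "t \<in> carrier R" for t
  proof -
    have "(\<Sum>b\<in>carrier R. of_bool (t \<otimes> x \<ominus> b \<in> B)) = (\<Sum>z\<in>carrier R. of_bool (z \<in> B))"
      using that x by (intro sum.reindex_bij_betw bij_betw_minus_left) auto
    also have "\<dots> = real (card B)"
      using fin B by (simp add: of_bool_def sum.If_cases Int_absorb1)
    finally show ?thesis .
  qed
  then show ?thesis
    by (simp add: sum.cartesian_product[symmetric])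
qed

text \<open>A line is determined by its heights over two distinct abscissae, and all pairs of
  heights occur. Summing over these pairs instead makes the two conditions independent, and the sum
  factors.\<close>

lemma (in field) sum_line_incidence_pairs:
  assumes fin: "finite (carrier R)" and x: "x \<in> carrier R" and y: "y \<in> carrier R" and "x \<noteq> y"
    and B: "B \<subseteq> carrier R"
  shows "(\<Sum>(t, b)\<in>carrier R \<times> carrier R.
            of_bool (t \<otimes> x \<ominus> b \<in> B) * of_bool (t \<otimes> y \<ominus> b \<in> B)) = (real (card B))\<^sup>2"
proof -
  have "(\<Sum>(t, b)\<in>carrier R \<times> carrier R.
            of_bool (t \<otimes> x \<ominus> b \<in> B) * of_bool (t \<otimes> y \<ominus> b \<in> B))
      = (\<Sum>p\<in>carrier R \<times> carrier R. of_bool (fst p \<in> B) * (of_bool (snd p \<in> B) :: real))"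
    using sum.reindex_bij_betw[OF bij_betw_line_coordinates[OF fin x y \<open>x \<noteq> y\<close>],
        of "\<lambda>p. of_bool (fst p \<in> B) * (of_bool (snd p \<in> B) :: real)"]
    by (simp add: case_prod_unfold)
  also have "\<dots> = (\<Sum>z\<in>carrier R. of_bool (z \<in> B)) * (\<Sum>z\<in>carrier R. of_bool (z \<in> B))"
    by (simp add: sum_product sum.cartesian_product case_prod_unfold)
  also have "\<dots> = (real (card B))\<^sup>2"
    using fin B by (simp add: of_bool_def sum.If_cases Int_absorb1 power2_eq_square)
  finally show ?thesis .
qed

text \<open>For a uniformly random line, the events that its height over \<open>x\<close> lies in
  \<open>B\<close> are pairwise independent for distinct \<open>x\<close>, so variances add. After
  scaling by the number \<open>q * q\<close> of lines, each \<open>x\<close> contributes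
  \<open>card B * (q - card B)\<close>.\<close>

lemma (in field) line_incidence_variance:
  assumes fin: "finite (carrier R)" and A: "A \<subseteq> carrier R" and B: "B \<subseteq> carrier R"
  defines "q \<equiv> real (card (carrier R))"
  shows "(\<Sum>(t, b)\<in>carrier R \<times> carrier R.
            (real (card {x \<in> A. t \<otimes> x \<ominus> b \<in> B}) - real (card A) * real (card B) / q)\<^sup>2)
         = real (card A) * real (card B) * (q - real (card B))"
proof -
  let ?L = "carrier R \<times> carrier R"
  let ?i = "\<lambda>x p. of_bool (fst p \<otimes> x \<ominus> snd p \<in> B) :: real"
  let ?N = "\<lambda>p. \<Sum>x\<in>A. ?i x p"
  let ?m = "real (card A) * real (card B) / q"
  have finA: "finite A" using fin A finite_subset by blast
  have q: "q > 0" using fin by (auto simp: q_def card_gt_0_iff)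
  have N: "real (card {x \<in> A. fst p \<otimes> x \<ominus> snd p \<in> B}) = ?N p" for p
    using finA by (simp add: of_bool_def sum.If_cases Int_def)
  have first: "(\<Sum>p\<in>?L. ?N p) = real (card A) * (q * real (card B))"
  proof -
    have "(\<Sum>p\<in>?L. ?N p) = (\<Sum>x\<in>A. \<Sum>p\<in>?L. ?i x p)" by (rule sum.swap)
    also have "\<dots> = (\<Sum>x\<in>A. q * real (card B))"
      using sum_line_incidences[OF fin _ B] A
      by (intro sum.cong) (auto simp: case_prod_unfold q_def)
    finally show ?thesis by simp
  qed
  have second: "(\<Sum>p\<in>?L. (?N p)\<^sup>2)
      = real (card A) * (q * real (card B) + (real (card A) - 1) * (real (card B))\<^sup>2)"
  proof -
    have "(\<Sum>p\<in>?L. (?N p)\<^sup>2) = (\<Sum>p\<in>?L. \<Sum>x\<in>A. \<Sum>y\<in>A. ?i x p * ?i y p)"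
      by (simp only: power2_eq_square sum_product)
    also have "\<dots> = (\<Sum>x\<in>A. \<Sum>p\<in>?L. \<Sum>y\<in>A. ?i x p * ?i y p)"
      by (rule sum.swap)
    also have "\<dots> = (\<Sum>x\<in>A. \<Sum>y\<in>A. \<Sum>p\<in>?L. ?i x p * ?i y p)"
      by (intro sum.cong refl sum.swap)
    also have "\<dots> = (\<Sum>x\<in>A. q * real (card B) + (real (card A) - 1) * (real (card B))\<^sup>2)"
    proof (rule sum.cong)
      fix x assume x: "x \<in> A"
      have "(\<Sum>y\<in>A. \<Sum>p\<in>?L. ?i x p * ?i y p)
          = (\<Sum>p\<in>?L. ?i x p * ?i x p) + (\<Sum>y\<in>A - {x}. \<Sum>p\<in>?L. ?i x p * ?i y p)"
        using finA x by (simp only: sum.remove)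
      \<comment> \<open>On the diagonal an indicator equals its square, so the first moment
        applies.\<close>
      also have "(\<Sum>p\<in>?L. ?i x p * ?i x p) = q * real (card B)"
        using sum_line_incidences[OF fin _ B, of x] A x
        by (simp add: case_prod_unfold q_def subset_eq flip: of_bool_conj)
      also have "(\<Sum>y\<in>A - {x}. \<Sum>p\<in>?L. ?i x p * ?i y p) = (\<Sum>y\<in>A - {x}. (real (card B))\<^sup>2)"
        using sum_line_incidence_pairs[OF fin _ _ _ B, of x] A x
        by (intro sum.cong refl) (auto simp: case_prod_unfold simp del: of_bool_conj)
      \<comment> \<open>Since \<open>x \<in> A\<close>, \<open>card A\<close> is positive and the
        truncated subtraction in \<open>card (A - {x})\<close> agrees with the real one.\<close>
      also have "\<dots> = (real (card A) - 1) * (real (card B))\<^sup>2"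
        using finA x card_gt_0_iff[of A] by (auto simp: of_nat_diff Suc_le_eq)
      finally show "(\<Sum>y\<in>A. \<Sum>p\<in>?L. ?i x p * ?i y p)
          = q * real (card B) + (real (card A) - 1) * (real (card B))\<^sup>2" .
    qed simp
    finally show ?thesis by simp
  qed
  have "(\<Sum>p\<in>?L. (?N p - ?m)\<^sup>2) = (\<Sum>p\<in>?L. (?N p)\<^sup>2 - 2 * ?m * ?N p + ?m\<^sup>2)"
    by (intro sum.cong refl) (simp add: power2_diff)
  also have "\<dots> = (\<Sum>p\<in>?L. (?N p)\<^sup>2) - 2 * ?m * (\<Sum>p\<in>?L. ?N p) + q\<^sup>2 * ?m\<^sup>2"
    by (simp only: sum.distrib sum_subtractf flip: sum_distrib_left)
      (simp add: q_def card_cartesian_product power2_eq_square)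
  also have "\<dots> = real (card A) * real (card B) * (q - real (card B))"
    unfolding first second using q by (simp add: field_simps power2_eq_square)
  finally show ?thesis
    by (simp only: case_prod_unfold N)
qed

section \<open>The nonzero powers and sets without power differences\<close>

definition (in ring) nonzero_powers :: "nat \<Rightarrow> 'a set"
  where "nonzero_powers k = (\<lambda>\<alpha>. \<alpha> [^] k) ` (carrier R - {\<zero>})"

text \<open>Dividing a fibre of the power map by one of its elements embeds it into the
  \<open>k\<close>-th roots of unity, of which a field has at most \<open>k\<close>. These fibres
  partition the \<open>q - 1\<close> nonzero elements.\<close>

lemma (in field) card_nonzero_powers:
  assumes fin: "finite (carrier R)" and "k > 0"
  shows "card (carrier R) - 1 \<le> k * card (nonzero_powers k)"
proof -
  let ?U = "carrier R - {\<zero>}"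
  let ?p = "\<lambda>\<alpha>. \<alpha> [^] k"
  have fibre: "card {\<alpha> \<in> ?U. ?p \<alpha> = z} \<le> k" if z: "z \<in> nonzero_powers k" for z
  proof -
    obtain \<beta> where \<beta>: "\<beta> \<in> ?U" "z = \<beta> [^] k" using z by (auto simp: nonzero_powers_def)
    then have unit: "\<beta> \<in> Units R" by (simp add: field_Units)
    have "inj_on (\<lambda>\<alpha>. \<alpha> \<otimes> inv \<beta>) {\<alpha> \<in> ?U. ?p \<alpha> = z}"
      using unit by (intro inj_onI) (metis (no_types, lifting) DiffD1 Units_inv_Units
          Units_inv_closed m_comm mem_Collect_eq Units_l_cancel)
    moreover have "(\<lambda>\<alpha>. \<alpha> \<otimes> inv \<beta>) ` {\<alpha> \<in> ?U. ?p \<alpha> = z} \<subseteq> {x \<in> carrier R. x [^] k = \<one>}"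
    proof (rule image_subsetI)
      fix \<alpha> assume "\<alpha> \<in> {\<alpha> \<in> ?U. ?p \<alpha> = z}"
      then have \<alpha>: "\<alpha> \<in> carrier R" "\<alpha> [^] k = z" by auto
      have "(\<alpha> \<otimes> inv \<beta>) [^] k = \<beta> [^] k \<otimes> inv \<beta> [^] k"
        using \<alpha> \<beta> unit by (simp add: nat_pow_distrib)
      also have "\<dots> = (\<beta> \<otimes> inv \<beta>) [^] k"
        using \<beta> unit by (simp only: nat_pow_distrib Units_closed Units_inv_closed)
      finally show "\<alpha> \<otimes> inv \<beta> \<in> {x \<in> carrier R. x [^] k = \<one>}"
        using \<alpha> unit by simp
    qed
    ultimately have "card {\<alpha> \<in> ?U. ?p \<alpha> = z} \<le> card {x \<in> carrier R. x [^] k = \<one>}"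
      using fin by (intro card_inj_on_le) auto
    also have "\<dots> \<le> k"
      using num_roots_le_deg[OF fin, of k] \<open>k > 0\<close> by simp
    finally show ?thesis .
  qed
  have "card (carrier R) - 1 = card ?U"
    using fin by (simp add: card_Diff_singleton)
  also have "\<dots> = (\<Sum>z\<in>nonzero_powers k. card {\<alpha> \<in> ?U. ?p \<alpha> = z})"
    using sum.image_gen[of ?U "\<lambda>_. 1::nat" ?p] fin by (simp add: nonzero_powers_def)
  also have "\<dots> \<le> (\<Sum>z\<in>nonzero_powers k. k)"
    by (intro sum_mono fibre)
  finally show ?thesis by (simp add: mult.commute)
qed

text \<open>Each of the \<open>?M\<close> incidence-free lines deviates from the mean
  \<open>?M / q\<close> by the whole mean. Their share \<open>?M * (?M / q)\<^sup>2\<close> is at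
  most the total squared deviation \<open>?M * (q - card ?P)\<close>, and cancelling
  \<open>?M\<close> gives the bound.\<close>

lemma (in field) no_power_difference_bound:
  assumes fin: "finite (carrier R)" and E: "E \<subseteq> carrier R"
    and none: "\<not> has_kth_power_difference R k E"
  defines "q \<equiv> real (card (carrier R))"
  shows "(real (card E) * real (card (nonzero_powers k)))\<^sup>2
           \<le> q\<^sup>2 * (q - real (card (nonzero_powers k)))"
proof -
  let ?P = "nonzero_powers k"
  let ?L = "carrier R \<times> carrier R"
  let ?M = "real (card E) * real (card ?P)"
  let ?lines = "(\<lambda>(t, y). (t, t \<otimes> y)) ` (?P \<times> E)"
  have P: "?P \<subseteq> carrier R" "\<And>t. t \<in> ?P \<Longrightarrow> t \<in> Units R"
    using Units_pow_closed by (auto simp: nonzero_powers_def field_Units)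
  have no_incidence: "{x \<in> E. t \<otimes> x \<ominus> t \<otimes> y \<in> ?P} = {}" if ty: "t \<in> ?P" "y \<in> E" for t y
  proof -
    have False if x: "x \<in> E" and s: "t \<otimes> x \<ominus> t \<otimes> y \<in> ?P" for x
    proof -
      obtain \<tau> \<sigma> where \<tau>: "\<tau> \<in> Units R" "t = \<tau> [^] k"
        and \<sigma>: "\<sigma> \<in> carrier R" "t \<otimes> x \<ominus> t \<otimes> y = \<sigma> [^] k"
        using ty(1) s by (auto simp: nonzero_powers_def field_Units)
      have c: "x \<in> carrier R" "y \<in> carrier R" "t \<in> carrier R" using x ty E P(1) by auto
      \<comment> \<open>The exclusion of zero from \<open>?P\<close> is what makes \<open>x\<close>
        and \<open>y\<close> distinct.\<close>
      have "t \<otimes> x \<ominus> t \<otimes> y \<noteq> \<zero>" using P(2)[OF s] by (auto simp: field_Units)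
      then have "x \<noteq> y" using c by auto
      have "inv \<tau> [^] k \<otimes> t = (inv \<tau> \<otimes> \<tau>) [^] k"
        using \<tau> by (simp only: \<tau>(2) nat_pow_distrib Units_closed Units_inv_closed)
      then have inv_t: "inv \<tau> [^] k \<otimes> t = \<one>" using \<tau>(1) by simp
      \<comment> \<open>A quotient of powers is a power:
        \<open>inv \<tau> \<otimes> \<sigma>\<close> is a \<open>k\<close>-th root of the height
        divided by \<open>t\<close>, which is \<open>x \<ominus> y\<close>.\<close>
      have "(inv \<tau> \<otimes> \<sigma>) [^] k = inv \<tau> [^] k \<otimes> (t \<otimes> x \<ominus> t \<otimes> y)"
        using \<tau>(1) \<sigma> by (simp add: nat_pow_distrib)
      also have "\<dots> = (inv \<tau> [^] k \<otimes> t) \<otimes> (x \<ominus> y)"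
      proof -
        have "inv \<tau> [^] k \<in> carrier R" using \<tau>(1) by simp
        then show ?thesis using c by algebra
      qed
      also have "\<dots> = x \<ominus> y" using inv_t c by simp
      finally have "is_kth_power R k (x \<ominus> y)"
        unfolding is_kth_power_def
        using \<tau>(1) \<sigma>(1) by (intro bexI[of _ "inv \<tau> \<otimes> \<sigma>"]) auto
      with none x ty(2) \<open>x \<noteq> y\<close> show False by (auto simp: has_kth_power_difference_def)
    qed
    then show ?thesis by blast
  qed
  have q: "q > 0" using fin by (auto simp: q_def card_gt_0_iff)
  \<comment> \<open>As \<open>t\<close> is a unit, different pairs give different lines, so there
    are exactly \<open>?M\<close> of them.\<close>
  have inj: "inj_on (\<lambda>(t, y). (t, t \<otimes> y)) (?P \<times> E)"
    using P E by (auto intro!: inj_onI dest: Units_l_cancel[THEN iffD1, rotated 3])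
  have "?M * (?M / q)\<^sup>2 = (\<Sum>(t, b)\<in>?lines. (?M / q)\<^sup>2)"
    using inj by (simp add: card_image card_cartesian_product)
  also have "\<dots> = (\<Sum>(t, b)\<in>?lines. (real (card {x \<in> E. t \<otimes> x \<ominus> b \<in> ?P}) - ?M / q)\<^sup>2)"
    by (intro sum.cong refl) (auto simp: no_incidence)
  also have "\<dots> \<le> (\<Sum>(t, b)\<in>?L. (real (card {x \<in> E. t \<otimes> x \<ominus> b \<in> ?P}) - ?M / q)\<^sup>2)"
    using fin P E by (intro sum_mono2) auto
  also have "\<dots> = ?M * (q - real (card ?P))"
    unfolding q_def by (rule line_incidence_variance[OF fin E P(1)])
  finally have *: "?M * (?M / q)\<^sup>2 \<le> ?M * (q - real (card ?P))" .
  \<comment> \<open>The factor \<open>?M\<close> can be cancelled only if it is nonzero; otherwise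
    the claim reduces to \<open>card ?P \<le> q\<close>.\<close>
  show ?thesis
  proof (cases "?M = 0")
    case True
    have "card ?P \<le> card (carrier R)" by (intro card_mono fin P)
    then show ?thesis unfolding True by (simp add: q_def)
  next
    case False
    then have "?M > 0" by (simp add: zero_less_mult_iff)
    with * have "(?M / q)\<^sup>2 \<le> q - real (card ?P)" by (rule mult_left_le_imp_le)
    with q show ?thesis by (simp add: power_divide field_simps)
  qed
qed

section \<open>The explicit size threshold and its asymptotic form\<close>

lemma (in field) has_kth_power_difference_if_large:
  assumes fin: "finite (carrier R)" and E: "E \<subseteq> carrier R" and k: "k > 0"
  defines "q \<equiv> real (card (carrier R))"
  assumes large: "real (card E) > q * real k / sqrt (q - 1)"
  shows "has_kth_power_difference R k E"
proof (rule ccontr)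
  assume none: "\<not> has_kth_power_difference R k E"
  let ?p = "real (card (nonzero_powers k))"
  have "card {\<zero>, \<one>} \<le> card (carrier R)" by (intro card_mono fin) auto
  then have q2: "q \<ge> 2" by (simp add: q_def)
  have "real (card (carrier R) - 1) \<le> real (k * card (nonzero_powers k))"
    using card_nonzero_powers[OF fin k] by (rule of_nat_mono)
  then have kp: "q - 1 \<le> real k * ?p" using q2 by (simp add: q_def)
  with q2 have "?p \<noteq> 0" by (intro notI) simp
  then have p1: "?p \<ge> 1" by simp
  \<comment> \<open>The lower bound \<open>(q - 1) / k\<close> for \<open>?p\<close> turns the size
    hypothesis into \<open>card E * ?p > q * sqrt (q - 1)\<close>. After squaring this contradicts
    the upper bound \<open>q\<^sup>2 * (q - ?p)\<close>, because \<open>?p \<ge> 1\<close>.\<close>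
  have "q * sqrt (q - 1) = q * (q - 1) / sqrt (q - 1)"
    using q2 by (simp add: real_div_sqrt flip: times_divide_eq_right)
  also have "\<dots> \<le> q * (real k * ?p) / sqrt (q - 1)"
    using q2 kp by (intro divide_right_mono mult_left_mono) auto
  also have "\<dots> = (q * real k / sqrt (q - 1)) * ?p" by simp
  also have "\<dots> < real (card E) * ?p"
    using large p1 by (intro mult_strict_right_mono) auto
  finally have "(q * sqrt (q - 1))\<^sup>2 < (real (card E) * ?p)\<^sup>2"
    using q2 by (intro power_strict_mono) auto
  also have "\<dots> \<le> q\<^sup>2 * (q - ?p)"
    unfolding q_def by (rule no_power_difference_bound[OF fin E none])
  also have "\<dots> \<le> q\<^sup>2 * (q - 1)"
    using p1 by (intro mult_left_mono) auto
  also have "\<dots> = (q * sqrt (q - 1))\<^sup>2"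
    using q2 by (simp add: power_mult_distrib)
  finally show False by simp
qed

theorem theorem3p4:
  fixes k :: nat
  assumes "k > 0"
  shows "(\<forall>(F :: ('a, 'b) ring_scheme) E q.
            field F \<longrightarrow> finite (carrier F) \<longrightarrow> card (carrier F) = q \<longrightarrow> E \<subseteq> carrier F \<longrightarrow>
            real (card E) > real q * real k / sqrt (real q - 1) \<longrightarrow>
            has_kth_power_difference F k E)
       \<and> (\<forall>C > real k. eventually_kth_power_difference k C)"
proof (intro conjI allI impI)
  fix F :: "('a, 'b) ring_scheme" and E q
  assume "field F" "finite (carrier F)" "card (carrier F) = q" "E \<subseteq> carrier F"
    "real (card E) > real q * real k / sqrt (real q - 1)"
  then show "has_kth_power_difference F k E"
    using field.has_kth_power_difference_if_large[of F E k] assms by simp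
next
  fix C :: real assume C: "C > real k"
  \<comment> \<open>The size threshold divided by \<open>sqrt q\<close> tends to \<open>k\<close>,
    so any constant \<open>C > k\<close> eventually exceeds it, from a point that depends on
    \<open>k\<close> and \<open>C\<close> only.\<close>
  have "((\<lambda>q. real q * real k / (sqrt (real q - 1) * sqrt (real q))) \<longlongrightarrow> real k) sequentially"
    by real_asymp
  then have "\<forall>\<^sub>F q in sequentially. real q * real k / (sqrt (real q - 1) * sqrt (real q)) < C"
    using C by (rule order_tendstoD)
  then have "\<forall>\<^sub>F q in sequentially. real q * real k / sqrt (real q - 1) < C * sqrt (real q)"
    using eventually_gt_at_top[of 0] by eventually_elim
      (simp add: pos_divide_less_eq flip: divide_divide_eq_left)
  then show "eventually_kth_power_difference k C"
    unfolding eventually_kth_power_difference_def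
  proof eventually_elim
    case (elim q)
    show ?case
    proof (intro allI impI)
      fix F :: "nat ring" and E
      assume "field F" "finite (carrier F)" "card (carrier F) = q" "E \<subseteq> carrier F"
        "real (card E) \<ge> C * sqrt (real q)"
      with elim show "has_kth_power_difference F k E"
        using field.has_kth_power_difference_if_large[of F E k] assms by simp
    qed
  qed
qed

end
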